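(* Let $n\ge 2$ and $m\ge 1$ be integers, let $u_0<u_1<\cdots<u_m$ be real numbers, let $a_i>0$, $k_i>0$ for $i=0,\dots,m$, $d_i\ge 0$ for $i=1,\dots,m$, and $A>0$. Let $\Omega=\{\bar\xi=(\xi_1,\ldots,\xi_m)\in\mathbb{R}^m : \xi_1>\xi_2>\cdots>\xi_m>0\}$ and define $E:\Omega\to\mathbb{R}$ by $$E(\bar\xi)=-\sum_{i=0}^{m-1}k_i(u_{i+1}-u_i)\ln\bigl(G(\xi_{i+1}/a_i)-G(\xi_i/a_i)\bigr)+k_mA\,G(\xi_m/a_m)+\frac14\sum_{i=1}^m d_i\xi_i^2,$$ where $\xi_0=+\infty$. Then for each $c\in\mathbb{R}$ the set $\Omega_c=\{\bar\xi\in\Omega : E(\bar\xi)\le c\}$ is compact.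
   Context: $G(y)=\int_y^{+\infty}s^{1-n}e^{-s^2/4}\,ds$ for $y>0$, with the convention $G(+\infty)=0$. *)

theory Defs
  imports "HOL-Analysis.Analysis"
begin

text \<open>The argument of \<open>G\<close> is an extended real so that the convention
  \<open>\<xi>\<^sub>0 = +\<infinity>\<close> can be kept literally; the convention \<open>G(+\<infinity>) = 0\<close> is the lemma below.
  Only arguments in \<open>(0, +\<infinity>]\<close> are meaningful.\<close>

definition G :: "nat \<Rightarrow> ereal \<Rightarrow> real" where
  "G n y = (LBINT s=y..\<infinity>. s powi (1 - int n) * exp (- (s\<^sup>2) / 4))"

lemma G_infinity: "G n \<infinity> = 0"
  by (simp add: G_def)

text \<open>Points of \<open>\<real>\<^sup>m\<close> are the functions in \<open>{1..m} \<rightarrow>\<^sub>E UNIV\<close>, the carrier of the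
  topological space \<open>powertop_real {1..m}\<close>.\<close>

definition Omega :: "nat \<Rightarrow> (nat \<Rightarrow> real) set" where
  "Omega m = {\<xi> \<in> {1..m} \<rightarrow>\<^sub>E UNIV. (\<forall>i\<in>{1..<m}. \<xi> i > \<xi> (i + 1)) \<and> \<xi> m > 0}"

definition with_infinity :: "(nat \<Rightarrow> real) \<Rightarrow> nat \<Rightarrow> ereal" where
  "with_infinity \<xi> i = (if i = 0 then \<infinity> else ereal (\<xi> i))"

definition E :: "nat \<Rightarrow> nat \<Rightarrow> (nat \<Rightarrow> real) \<Rightarrow> (nat \<Rightarrow> real) \<Rightarrow> (nat \<Rightarrow> real) \<Rightarrow> (nat \<Rightarrow> real)
    \<Rightarrow> real \<Rightarrow> (nat \<Rightarrow> real) \<Rightarrow> real" where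
  "E n m u a k d A \<xi> =
     - (\<Sum>i=0..<m. k i * (u (i + 1) - u i) *
          ln (G n (with_infinity \<xi> (i + 1) / ereal (a i)) - G n (with_infinity \<xi> i / ereal (a i))))
     + k m * A * G n (with_infinity \<xi> m / ereal (a m))
     + 1 / 4 * (\<Sum>i=1..m. d i * (\<xi> i)\<^sup>2)"

end

theory Submission
  imports Defs "HOL-Real_Asymp.Real_Asymp"
begin

text \<open>Write \<open>g = G (\<xi>\<^sub>m / a\<^sub>m)\<close>. Every difference inside a logarithm is at most
  \<open>G (\<xi>\<^sub>m / a\<^sub>i) \<le> C\<^sub>i (1 + g)\<close>, so \<open>E \<ge> \<kappa> g - W ln (1 + g) - S\<close> with constants
  \<open>\<kappa>, W > 0\<close>. Hence \<open>E \<le> c\<close> bounds \<open>g\<close>, and \<open>\<xi>\<^sub>m\<close> stays away from \<open>0\<close> because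
  \<open>G\<close> blows up there. Now all the differences are bounded above, so \<open>E \<le> c\<close> also bounds
  each of them below by a positive constant; for \<open>i = 0\<close> this gives an upper bound for \<open>\<xi>\<^sub>1\<close>
  since \<open>G\<close> tends to \<open>0\<close> at infinity. The sublevel set therefore lies in a compact box, inside
  the closed subset on which all differences are bounded below, and there \<open>E\<close> is continuous.\<close>

section \<open>The integrand of \<open>G\<close> and its integrability away from 0\<close>

definition integrand :: "nat \<Rightarrow> real \<Rightarrow> real" where
  "integrand n s = s powi (1 - int n) * exp (- (s\<^sup>2) / 4)"

lemma integrand_pos: "s > 0 \<Longrightarrow> integrand n s > 0"
  by (simp add: integrand_def)

lemma isCont_kernel: "s \<noteq> 0 \<Longrightarrow> isCont (integrand n) s"
  unfolding integrand_def by (intro continuous_intros) auto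

lemma integrand_measurable: "set_borel_measurable borel {y<..} (integrand n)" if "y > 0"
proof -
  have "continuous_on {y<..} (integrand n)"
    using that by (intro continuous_at_imp_continuous_on) (auto intro!: isCont_kernel)
  thus ?thesis
    unfolding set_borel_measurable_def by (intro borel_measurable_continuous_on_indicator) auto
qed

text \<open>The factor \<open>s\<close> gives the Gaussian the elementary antiderivative
  \<open>?F\<close>, so the fundamental theorem on the half line yields both claims. This function
  serves as the majorant for \<open>integrand n\<close>.\<close>

lemma dominating_integral:
  fixes y :: real
  assumes "y > 0"
  shows "set_integrable lborel {y<..} (\<lambda>s. s * exp (- (s\<^sup>2) / 4))"
    and "(LBINT s:{y<..}. s * exp (- (s\<^sup>2) / 4)) = 2 * exp (- (y\<^sup>2) / 4)"
proof -
  let ?f = "\<lambda>s::real. s * exp (- (s\<^sup>2) / 4)" and ?F = "\<lambda>s::real. - 2 * exp (- (s\<^sup>2) / 4)"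
  have 1: "DERIV ?F x :> ?f x" for x
    by (auto intro!: derivative_eq_intros)
  have "(?F \<longlongrightarrow> ?F y) (at_right y)"
    by (intro tendsto_intros) auto
  hence A: "((?F \<circ> real_of_ereal) \<longlongrightarrow> ?F y) (at_right (ereal y))"
    by (simp add: ereal_tendsto_simps)
  have "(?F \<longlongrightarrow> 0) at_top"
    by real_asymp
  hence B: "((?F \<circ> real_of_ereal) \<longlongrightarrow> 0) (at_left \<infinity>)"
    by (simp add: ereal_tendsto_simps)
  note ftc = interval_integral_FTC_nonneg[of "ereal y" \<infinity> ?F ?f, OF _ 1 _ _ A B]
  have eq: "einterval (ereal y) \<infinity> = {y<..}"
    by (auto simp: einterval_iff)
  show "set_integrable lborel {y<..} ?f"
    using ftc(1) assms unfolding eq by (auto intro!: continuous_intros)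
  show "(LBINT s:{y<..}. ?f s) = 2 * exp (- (y\<^sup>2) / 4)"
    using ftc(2) assms unfolding interval_integral_to_infinity_eq
    by (auto intro!: continuous_intros)
qed

text \<open>The exponent \<open>1 - int n\<close> is negative, so the power is largest at
  \<open>s = y\<close>; the factor \<open>s / y\<close>, at least 1, is then inserted to reach a
  multiple of the explicitly integrable function.\<close>

lemma integrand_le:
  assumes "n \<ge> 2" "0 < y" "y \<le> s"
  shows "integrand n s \<le> y powi (1 - int n) / y * (s * exp (- (s\<^sup>2) / 4))"
proof -
  have "s powi (1 - int n) \<le> y powi (1 - int n)"
    using assms by (intro power_int_antimono) auto
  also have "\<dots> \<le> y powi (1 - int n) / y * s"
    using assms by (simp add: field_simps)
  finally show ?thesis
    unfolding integrand_def mult.assoc[symmetric] by (intro mult_right_mono) auto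
qed

lemma integrand_integrable:
  assumes "n \<ge> 2" "y > 0"
  shows "set_integrable lborel {y<..} (integrand n)"
proof (rule set_integrable_bound)
  show "set_integrable lborel {y<..} (\<lambda>s. y powi (1 - int n) / y * (s * exp (- (s\<^sup>2) / 4)))"
    using dominating_integral(1)[OF assms(2)] by (rule set_integrable_mult_right)
  show "set_borel_measurable lborel {y<..} (integrand n)"
    using integrand_measurable[OF assms(2)] by (simp add: set_borel_measurable_def)
  show "AE s in lborel. s \<in> {y<..} \<longrightarrow>
      norm (integrand n s) \<le> norm (y powi (1 - int n) / y * (s * exp (- (s\<^sup>2) / 4)))"
    using integrand_le[OF assms] integrand_pos[of _ n] assms
    by (intro always_eventually) (smt (verit) greaterThan_iff real_norm_def)
qed

section \<open>\<open>G\<close> on the positive reals: sign, decay, derivative, monotonicity\<close>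

lemma G_eq: "G n (ereal y) = (LBINT s:{y<..}. integrand n s)"
  by (simp add: G_def integrand_def interval_integral_to_infinity_eq)

lemma G_nonneg:
  assumes "y > 0"
  shows "G n (ereal y) \<ge> 0"
  unfolding G_eq set_lebesgue_integral_def using integrand_pos[of _ n] assms
  by (intro integral_nonneg_AE always_eventually) (auto simp: indicator_def less_imp_le)

lemma G_le:
  assumes "n \<ge> 2" "y > 0"
  shows "G n (ereal y) \<le> y powi (1 - int n) / y * (2 * exp (- (y\<^sup>2) / 4))"
proof -
  have "G n (ereal y) \<le> (LBINT s:{y<..}. y powi (1 - int n) / y * (s * exp (- (s\<^sup>2) / 4)))"
    unfolding G_eq using assms
    by (intro set_integral_mono integrand_integrable set_integrable_mult_right dominating_integral
        integrand_le) auto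
  also have "\<dots> = y powi (1 - int n) / y * (2 * exp (- (y\<^sup>2) / 4))"
    using dominating_integral(2)[OF assms(2)] by simp
  finally show ?thesis .
qed

lemma G_tendsto_0:
  assumes "n \<ge> 2"
  shows "((\<lambda>y. G n (ereal y)) \<longlongrightarrow> 0) at_top"
proof (rule tendsto_sandwich)
  show "\<forall>\<^sub>F y in at_top. 0 \<le> G n (ereal y)"
    using eventually_gt_at_top[of 0] by eventually_elim (rule G_nonneg)
  show "\<forall>\<^sub>F y in at_top. G n (ereal y) \<le> 2 * exp (- (y\<^sup>2) / 4)"
    using eventually_ge_at_top[of 1]
  proof eventually_elim
    case (elim y)
    have "y powi (1 - int n) \<le> 1 powi (1 - int n)"
      using elim assms by (intro power_int_antimono) auto
    hence "y powi (1 - int n) / y \<le> 1"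
      using elim by (simp add: divide_le_eq)
    hence "y powi (1 - int n) / y * (2 * exp (- (y\<^sup>2) / 4)) \<le> 1 * (2 * exp (- (y\<^sup>2) / 4))"
      by (intro mult_right_mono) auto
    thus ?case
      using G_le[OF assms, of y] elim by linarith
  qed
  show "((\<lambda>y::real. 2 * exp (- (y\<^sup>2) / 4)) \<longlongrightarrow> 0) at_top"
    by real_asymp
qed auto

lemma DERIV_G:
  assumes "n \<ge> 2" "y > 0"
  shows "((\<lambda>y. G n (ereal y)) has_real_derivative - integrand n y) (at y)"
proof -
  \<comment> \<open>A base point strictly between the singularity at 0 and \<open>y\<close>: near
    \<open>y\<close>, \<open>G\<close> is the constant \<open>G n b\<close> minus a proper integral
    starting at \<open>b\<close>, whose integrand is continuous.\<close>
  define b where "b = y / 2"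
  have b: "0 < b" "b < y"
    using assms by (auto simp: b_def)
  have eq: "G n (ereal x) = G n (ereal b) - (LBINT s=b..x. integrand n s)" if "x \<in> {b<..<y + 1}" for x
  proof -
    have "einterval (ereal b) \<infinity> = {b<..}"
      by (auto simp: einterval_iff)
    hence "interval_lebesgue_integrable lborel (min b (min x \<infinity>)) (max b (max x \<infinity>)) (integrand n)"
      using that integrand_integrable[OF assms(1) b(1)]
      by (simp add: interval_lebesgue_integrable_def min_def max_def)
    from interval_integral_sum[OF this] show ?thesis
      by (simp add: G_def integrand_def)
  qed
  have "((\<lambda>u. LBINT s=b..u. integrand n s) has_vector_derivative integrand n y) (at y within {b..y + 1})"
    using b by (intro interval_integral_FTC2 continuous_at_imp_continuous_on) 
      (auto intro!: isCont_kernel)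
  hence "((\<lambda>u. LBINT s=b..u. integrand n s) has_real_derivative integrand n y) (at y)"
    using b by (simp add: has_real_derivative_iff_has_vector_derivative at_within_Icc_at)
  hence "((\<lambda>x. G n (ereal b) - (LBINT s=b..x. integrand n s)) has_real_derivative - integrand n y) (at y)"
    by (auto intro!: derivative_eq_intros)
  thus ?thesis
    using b by (rule_tac has_field_derivative_transform_within_open[where S = "{b<..<y + 1}"])
      (auto simp: eq)
qed

lemma G_strict_antimono:
  assumes "n \<ge> 2" "0 < x" "x < y"
  shows "G n (ereal y) < G n (ereal x)"
proof (rule DERIV_neg_imp_decreasing[OF assms(3)])
  fix z assume "x \<le> z" "z \<le> y"
  with assms show "\<exists>D. ((\<lambda>y. G n (ereal y)) has_real_derivative D) (at z) \<and> D < 0"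
    using DERIV_G[of n z] integrand_pos[of z n] by (intro exI[of _ "- integrand n z"]) auto
qed

lemma G_antimono:
  assumes "n \<ge> 2" "0 < x" "x \<le> y"
  shows "G n (ereal y) \<le> G n (ereal x)"
  using G_strict_antimono[of n x y] assms by (cases "x = y") auto

lemma G_pos:
  assumes "n \<ge> 2" "y > 0"
  shows "G n (ereal y) > 0"
  using G_strict_antimono[of n y "y + 1"] G_nonneg[of "y + 1" n] assms by auto

section \<open>Growth of \<open>G\<close> near 0 and its behaviour under scaling\<close>

lemma G_ge_ln:
  assumes "n \<ge> 2" "0 < y" "y \<le> 1"
  shows "exp (- 1 / 4) * - ln y \<le> G n (ereal y)"
proof -
  \<comment> \<open>On (0, 1] the integrand is at least \<open>exp (- 1 / 4) / z\<close>, because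
    \<open>n \<ge> 2\<close>. Hence \<open>?f\<close> does not increase there, and
    \<open>?f 1\<close> is just \<open>G n 1\<close>, which is nonnegative.\<close>
  let ?f = "\<lambda>z. G n (ereal z) + exp (- 1 / 4) * ln z"
  have "?f 1 \<le> ?f y"
  proof (rule DERIV_nonpos_imp_nonincreasing[OF assms(3)])
    fix z assume z: "y \<le> z" "z \<le> 1"
    hence "z > 0" using assms by simp
    have "1 / z = z powi (-1)"
      by (simp add: power_int_minus field_simps)
    also have "\<dots> \<le> z powi (1 - int n)"
      using z \<open>z > 0\<close> assms by (intro power_int_decreasing) auto
    finally have "exp (- 1 / 4) * (1 / z) \<le> exp (- (z\<^sup>2) / 4) * z powi (1 - int n)"
      using z \<open>z > 0\<close> by (intro mult_mono) (auto simp: power_le_one_iff)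
    hence "- integrand n z + exp (- 1 / 4) * (1 / z) \<le> 0"
      by (simp add: integrand_def mult.commute)
    moreover have "(?f has_real_derivative - integrand n z + exp (- 1 / 4) * (1 / z)) (at z)"
      using \<open>z > 0\<close> by (auto intro!: derivative_eq_intros DERIV_G assms)
    ultimately show "\<exists>D. (?f has_real_derivative D) (at z) \<and> D \<le> 0"
      by blast
  qed
  thus ?thesis
    using G_nonneg[of 1 n] by simp
qed

text \<open>A power bound on \<open>G\<close> near \<open>0\<close> would not do: for \<open>n = 2\<close> the logarithm of a power is of the
  order of \<open>G\<close> itself, so the logarithmic terms of \<open>E\<close> have to be compared with \<open>ln G\<close>.\<close>

lemma G_scale:
  assumes "n \<ge> 2" "l > 0"
  obtains C where "C \<ge> 1" "\<And>y. y > 0 \<Longrightarrow> G n (ereal (l * y)) \<le> C * (1 + G n (ereal y))"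
proof -
  \<comment> \<open>The factor \<open>l * l powi (1 - int n)\<close> comes from the chain rule for
    \<open>G n (l * y)\<close>; \<open>exp (1 / 4)\<close> compensates the Gaussian in
    \<open>integrand n y\<close>, which is at least \<open>exp (- 1 / 4)\<close> for
    \<open>y \<le> 1\<close>. So \<open>K * G n y\<close> falls at least as fast as
    \<open>G n (l * y)\<close> on (0, 1]; beyond 1, monotonicity suffices.\<close>
  define K where "K = l * l powi (1 - int n) * exp (1 / 4)"
  have "K > 0"
    using assms by (simp add: K_def)
  define C where "C = 1 + K + G n (ereal l)"
  have C: "C \<ge> 1"
    using \<open>K > 0\<close> G_pos[OF assms] by (simp add: C_def)
  have "G n (ereal (l * y)) \<le> C * (1 + G n (ereal y))" if "y > 0" for y
  proof -
    have "G n (ereal (l * y)) \<le> G n (ereal l) + K * G n (ereal y)"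
    proof (cases "y \<le> 1")
      case True
      let ?h = "\<lambda>y. K * G n (ereal y) - G n (ereal (l * y))"
      have "?h 1 \<le> ?h y"
      proof (rule DERIV_nonpos_imp_nonincreasing[OF True])
        fix z assume z: "y \<le> z" "z \<le> 1"
        hence "z > 0" using that by simp
        have "exp (- ((l * z)\<^sup>2) / 4) \<le> 1"
          by simp
        also have "1 \<le> exp (1 / 4) * exp (- (z\<^sup>2) / 4)"
          using z \<open>z > 0\<close> by (simp flip: exp_add add: power_le_one_iff)
        finally have "l * l powi (1 - int n) * z powi (1 - int n) * exp (- ((l * z)\<^sup>2) / 4)
            \<le> l * l powi (1 - int n) * z powi (1 - int n) * (exp (1 / 4) * exp (- (z\<^sup>2) / 4))"
          using \<open>z > 0\<close> assms by (intro mult_left_mono) auto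
        hence "K * (- integrand n z) - (- integrand n (l * z)) * l \<le> 0"
          by (simp add: integrand_def K_def power_int_mult_distrib mult_ac)
        moreover have "(?h has_real_derivative K * (- integrand n z) - (- integrand n (l * z)) * l) (at z)"
        proof (intro DERIV_diff DERIV_cmult DERIV_G)
          show "((\<lambda>y. G n (ereal (l * y))) has_real_derivative (- integrand n (l * z)) * l) (at z)"
            using \<open>z > 0\<close> assms
            by (intro DERIV_chain2[where f = "\<lambda>y. G n (ereal y)" and g = "\<lambda>y. l * y"] DERIV_G)
              (auto intro!: derivative_eq_intros)
        qed (use assms \<open>z > 0\<close> in auto)
        ultimately show "\<exists>D. (?h has_real_derivative D) (at z) \<and> D \<le> 0"
          by blast
      qed
      moreover have "K * G n (ereal 1) \<ge> 0"
        using \<open>K > 0\<close> G_nonneg[of 1 n] by simp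
      ultimately show ?thesis
        by simp
    next
      case False
      hence "G n (ereal (l * y)) \<le> G n (ereal l)"
        using assms by (intro G_antimono) auto
      moreover have "K * G n (ereal y) \<ge> 0"
        using \<open>K > 0\<close> G_nonneg[OF that] by simp
      ultimately show ?thesis
        by simp
    qed
    also have "\<dots> \<le> C * (1 + G n (ereal y))"
      using \<open>K > 0\<close> G_pos[OF assms] G_pos[OF assms(1) that] 
      by (simp add: C_def algebra_simps)
    finally show ?thesis .
  qed
  with C show thesis by (rule that)
qed

lemma tendsto_G:
  assumes "n \<ge> 2" "(f \<longlongrightarrow> l) F" "l > 0"
  shows "((\<lambda>x. G n (ereal (f x))) \<longlongrightarrow> G n (ereal l)) F"
  using DERIV_isCont[OF DERIV_G[OF assms(1,3)]] assms(2) by (rule isCont_tendsto_compose)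

section \<open>The differences inside the logarithms, and the ordering in
  \<open>Omega\<close>\<close>

lemma with_infinity_divide:
  assumes "b > 0"
  shows "with_infinity \<xi> i / ereal b = (if i = 0 then \<infinity> else ereal (\<xi> i / b))"
  using assms by (simp add: with_infinity_def)

definition gap :: "nat \<Rightarrow> (nat \<Rightarrow> real) \<Rightarrow> (nat \<Rightarrow> real) \<Rightarrow> nat \<Rightarrow> real" where
  "gap n a \<xi> i = G n (with_infinity \<xi> (i + 1) / ereal (a i)) - G n (with_infinity \<xi> i / ereal (a i))"

lemma gap_eq:
  assumes "a i > 0"
  shows "gap n a \<xi> i = G n (ereal (\<xi> (i + 1) / a i)) - (if i = 0 then 0 else G n (ereal (\<xi> i / a i)))"
  using assms by (simp add: gap_def with_infinity_divide G_infinity)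

lemma E_eq:
  assumes "m \<ge> 1" "a m > 0"
  shows "E n m u a k d A \<xi> = - (\<Sum>i=0..<m. k i * (u (i + 1) - u i) * ln (gap n a \<xi> i))
    + k m * A * G n (ereal (\<xi> m / a m)) + 1 / 4 * (\<Sum>i=1..m. d i * (\<xi> i)\<^sup>2)"
  using assms by (simp add: E_def gap_def with_infinity_divide)

lemma Omega_antimono:
  assumes "\<xi> \<in> Omega m" "i \<le> j" "1 \<le> i" "j \<le> m"
  shows "\<xi> j \<le> \<xi> i"
  using assms(2,4)
proof (induction j rule: dec_induct)
  case (step j)
  have "\<xi> (Suc j) < \<xi> j"
    using assms(1,3) step by (auto simp: Omega_def)
  with step show ?case
    by simp
qed simp

lemma Omega_pos:
  assumes "\<xi> \<in> Omega m" "1 \<le> i" "i \<le> m"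
  shows "\<xi> i > 0"
  using Omega_antimono[OF assms(1,3,2)] assms(1) by (force simp: Omega_def)

lemma gap_pos:
  assumes "n \<ge> 2" "\<xi> \<in> Omega m" "i < m" "a i > 0"
  shows "gap n a \<xi> i > 0"
proof -
  have "\<xi> (i + 1) > 0"
    using assms by (intro Omega_pos) auto
  moreover have "\<xi> (i + 1) < \<xi> i" if "i \<noteq> 0"
    using that assms by (auto simp: Omega_def)
  ultimately show ?thesis
    using assms by (auto simp: gap_eq intro!: G_pos G_strict_antimono divide_strict_right_mono)
qed

text \<open>Discarding the subtracted value and moving the remaining argument down to the smallest
  coordinate can only increase the difference. This reduces all upper bounds to the single variable
  \<open>\<xi> m\<close>.\<close>

lemma gap_le:
  assumes "n \<ge> 2" "\<xi> \<in> Omega m" "i < m" "a i > 0"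
  shows "gap n a \<xi> i \<le> G n (ereal (\<xi> m / a i))"
proof -
  have pos: "\<xi> m > 0" and le: "\<xi> m \<le> \<xi> (i + 1)"
    using assms by (auto intro: Omega_pos Omega_antimono)
  have "(if i = 0 then 0 else G n (ereal (\<xi> i / a i))) \<ge> 0"
    using Omega_pos[of \<xi> m i] assms by (auto intro!: G_nonneg)
  moreover have "G n (ereal (\<xi> (i + 1) / a i)) \<le> G n (ereal (\<xi> m / a i))"
    using pos le assms by (intro G_antimono divide_right_mono) auto
  ultimately show ?thesis
    using assms by (simp add: gap_eq)
qed

text \<open>The tangent bound \<open>ln x \<le> x - 1\<close> at
  \<open>x = (1 + g) * \<epsilon>\<close>, with \<open>W * \<epsilon> = \<kappa> / 2\<close>, lets
  the logarithm consume only half of the linear term. The absolute value in the chosen bound ensures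
  \<open>B \<ge> 0\<close>.\<close>

lemma linear_minus_ln_bounded_imp_bounded:
  fixes \<kappa> W c :: real
  assumes "\<kappa> > 0" "W > 0"
  obtains B where "B \<ge> 0" "\<And>g. g > 0 \<Longrightarrow> \<kappa> * g - W * ln (1 + g) \<le> c \<Longrightarrow> g \<le> B"
proof -
  define \<epsilon> where "\<epsilon> = \<kappa> / (2 * W)"
  have eps: "\<epsilon> > 0" "W * \<epsilon> = \<kappa> / 2"
    using assms by (auto simp: \<epsilon>_def)
  have "g \<le> \<bar>(c + \<kappa> / 2 - W * ln \<epsilon>) / (\<kappa> / 2)\<bar>" if "g > 0" "\<kappa> * g - W * ln (1 + g) \<le> c" for g
  proof -
    have "ln (1 + g) + ln \<epsilon> = ln ((1 + g) * \<epsilon>)"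
      using that eps by (simp add: ln_mult)
    also have "\<dots> \<le> (1 + g) * \<epsilon>"
      using that eps ln_le_minus_one[of "(1 + g) * \<epsilon>"] by simp
    finally have "W * (ln (1 + g) + ln \<epsilon>) \<le> W * ((1 + g) * \<epsilon>)"
      using assms by (intro mult_left_mono) auto
    also have "\<dots> = (1 + g) * (\<kappa> / 2)"
      unfolding eps(2)[symmetric] by (simp add: mult_ac)
    finally have "g * (\<kappa> / 2) \<le> c + \<kappa> / 2 - W * ln \<epsilon>"
      using that by (simp add: algebra_simps)
    hence "g \<le> (c + \<kappa> / 2 - W * ln \<epsilon>) / (\<kappa> / 2)"
      using assms by (subst pos_le_divide_eq) auto
    thus ?thesis by linarith
  qed
  with abs_ge_zero show thesis
    by (rule that)
qed

section \<open>Uniform bounds on the sublevel set\<close>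

lemma sublevel_bounds:
  fixes n m :: nat and u a k d :: "nat \<Rightarrow> real" and A c :: real
  assumes n: "n \<ge> 2" and m: "m \<ge> 1"
    and u: "\<And>i. i < m \<Longrightarrow> u i < u (i + 1)"
    and a: "\<And>i. i \<le> m \<Longrightarrow> a i > 0"
    and k: "\<And>i. i \<le> m \<Longrightarrow> k i > 0"
    and d: "\<And>i. 1 \<le> i \<Longrightarrow> i \<le> m \<Longrightarrow> d i \<ge> 0"
    and A: "A > 0"
  obtains \<delta> M \<eta> where "\<delta> > 0" "\<And>i. i < m \<Longrightarrow> \<eta> i > 0"
    and "\<And>\<xi> i. \<xi> \<in> Omega m \<Longrightarrow> E n m u a k d A \<xi> \<le> c \<Longrightarrow> i \<in> {1..m} \<Longrightarrow> \<xi> i \<in> {\<delta>..M}"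
    and "\<And>\<xi> i. \<xi> \<in> Omega m \<Longrightarrow> E n m u a k d A \<xi> \<le> c \<Longrightarrow> i < m \<Longrightarrow> \<eta> i \<le> gap n a \<xi> i"
proof -
  define w where "w i = k i * (u (i + 1) - u i)" for i
  have w: "w i > 0" if "i < m" for i
    using k[of i] u[of i] that by (simp add: w_def)
  define W where "W = (\<Sum>i=0..<m. w i)"
  have W: "W > 0"
    unfolding W_def using m w by (intro sum_pos) auto
  define \<kappa> where "\<kappa> = k m * A"
  have \<kappa>: "\<kappa> > 0"
    using k[of m] A by (simp add: \<kappa>_def)
  have am: "a m > 0"
    using a by simp
  \<comment> \<open>The differences involve \<open>\<xi> m / a i\<close>, whereas the coercive term
    of \<open>E\<close> involves \<open>\<xi> m / a m\<close>; scaling by \<open>a m / a i\<close>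
    makes them comparable.\<close>
  have "\<exists>C\<ge>1. \<forall>y>0. G n (ereal (y / a i)) \<le> C * (1 + G n (ereal (y / a m)))" if i: "i < m" for i
  proof -
    have ai: "a i > 0"
      using a i by simp
    obtain C where C: "C \<ge> 1" "\<And>y. y > 0 \<Longrightarrow> G n (ereal (a m / a i * y)) \<le> C * (1 + G n (ereal y))"
      using G_scale[OF n, of "a m / a i"] ai am by auto
    have "G n (ereal (y / a i)) \<le> C * (1 + G n (ereal (y / a m)))" if "y > 0" for y
      using C(2)[of "y / a m"] that am by simp
    with C(1) show ?thesis by blast
  qed
  then obtain C where C1: "\<And>i. i < m \<Longrightarrow> C i \<ge> 1"
    and C: "\<And>i y. i < m \<Longrightarrow> y > 0 \<Longrightarrow> G n (ereal (y / a i)) \<le> C i * (1 + G n (ereal (y / a m)))"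
    by metis
  define S where "S = (\<Sum>i=0..<m. w i * ln (C i))"
  obtain B where B: "B \<ge> 0" "\<And>g. g > 0 \<Longrightarrow> \<kappa> * g - W * ln (1 + g) \<le> c + S \<Longrightarrow> g \<le> B"
    using linear_minus_ln_bounded_imp_bounded[OF \<kappa> W] by blast
  define P where "P i = C i * (1 + B)" for i
  have P: "P i \<ge> 1" if "i < m" for i
    using mult_mono[of 1 "C i" 1 "1 + B"] C1[OF that] B(1) by (simp add: P_def)
  \<comment> \<open>Replacing every other difference by its upper bound \<open>P i\<close> in
    \<open>E \<le> c\<close> leaves \<open>w j * ln (gap n a \<xi> j) \<ge> - V\<close>;
    \<open>\<eta> j\<close> is the value that gives equality.\<close>
  define V where "V = c + (\<Sum>i=0..<m. w i * ln (P i))"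
  define \<eta> where "\<eta> i = exp (- V / w i)" for i

  have E_ge: "- (\<Sum>i=0..<m. w i * ln (gap n a \<xi> i)) + \<kappa> * G n (ereal (\<xi> m / a m)) \<le> c"
    if "E n m u a k d A \<xi> \<le> c" for \<xi>
  proof -
    have "(\<Sum>i=1..m. d i * (\<xi> i)\<^sup>2) \<ge> 0"
      using d by (intro sum_nonneg) auto
    thus ?thesis
      using that by (simp add: E_eq[where a = a, OF m am] w_def \<kappa>_def)
  qed

  have gap_bounds: "gap n a \<xi> i > 0" "gap n a \<xi> i \<le> C i * (1 + G n (ereal (\<xi> m / a m)))"
    if "\<xi> \<in> Omega m" "i < m" for \<xi> i
  proof -
    have "\<xi> m > 0"
      using that Omega_pos[of \<xi> m m] by simp
    thus "gap n a \<xi> i \<le> C i * (1 + G n (ereal (\<xi> m / a m)))"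
      using gap_le[of n \<xi> m i a] C[of i "\<xi> m"] a[of i] n that by linarith
    show "gap n a \<xi> i > 0"
      using that n a by (intro gap_pos) auto
  qed

  have G_le_B: "G n (ereal (\<xi> m / a m)) \<le> B" if \<xi>: "\<xi> \<in> Omega m" "E n m u a k d A \<xi> \<le> c" for \<xi>
  proof (rule B(2))
    let ?g = "G n (ereal (\<xi> m / a m))"
    show g: "?g > 0"
      using \<xi> Omega_pos[of \<xi> m m] m am by (intro G_pos n) auto
    have "(\<Sum>i=0..<m. w i * ln (gap n a \<xi> i)) \<le> (\<Sum>i=0..<m. w i * (ln (C i) + ln (1 + ?g)))"
    proof (intro sum_mono mult_left_mono)
      fix i assume "i \<in> {0..<m}"
      hence i: "i < m" by simp
      have "ln (gap n a \<xi> i) \<le> ln (C i * (1 + ?g))"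
        using gap_bounds[OF \<xi>(1) i] by (subst ln_le_cancel_iff) auto
      also have "\<dots> = ln (C i) + ln (1 + ?g)"
        using C1[OF i] g by (simp add: ln_mult)
      finally show "ln (gap n a \<xi> i) \<le> ln (C i) + ln (1 + ?g)" .
      show "w i \<ge> 0" using w[OF i] by simp
    qed
    also have "\<dots> = S + W * ln (1 + ?g)"
      by (simp add: S_def W_def distrib_left sum.distrib sum_distrib_right)
    finally show "\<kappa> * ?g - W * ln (1 + ?g) \<le> c + S"
      using E_ge[OF \<xi>(2)] by simp
  qed

  have gap_ge: "\<eta> j \<le> gap n a \<xi> j" if \<xi>: "\<xi> \<in> Omega m" "E n m u a k d A \<xi> \<le> c" and j: "j < m" for \<xi> j
  proof -
    have le: "w i * ln (gap n a \<xi> i) \<le> w i * ln (P i)" if i: "i < m" for i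
    proof (intro mult_left_mono)
      have "gap n a \<xi> i \<le> P i"
        unfolding P_def using C1[OF i] G_le_B[OF \<xi>]
        by (intro order.trans[OF gap_bounds(2)[OF \<xi>(1) i]] mult_left_mono) auto
      thus "ln (gap n a \<xi> i) \<le> ln (P i)"
        using gap_bounds(1)[OF \<xi>(1) i] by (subst ln_le_cancel_iff) auto
    qed (use w[OF i] in simp)
    have "(\<Sum>i\<in>{0..<m} - {j}. w i * ln (gap n a \<xi> i)) \<le> (\<Sum>i\<in>{0..<m} - {j}. w i * ln (P i))"
      using le by (intro sum_mono) auto
    \<comment> \<open>Restoring the summand \<open>j\<close> is harmless because
      \<open>P j \<ge> 1\<close>, and it makes \<open>V\<close> independent of
      \<open>j\<close>.\<close>
    also have "\<dots> \<le> (\<Sum>i=0..<m. w i * ln (P i))"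
    proof (intro sum_mono2)
      fix i assume "i \<in> {0..<m} - ({0..<m} - {j})"
      thus "0 \<le> w i * ln (P i)"
        using w[of i] P[of i] by simp
    qed auto
    finally have "(\<Sum>i=0..<m. w i * ln (gap n a \<xi> i))
        \<le> w j * ln (gap n a \<xi> j) + (\<Sum>i=0..<m. w i * ln (P i))"
      using j by (subst sum.remove[of _ j]) auto
    moreover have "\<kappa> * G n (ereal (\<xi> m / a m)) \<ge> 0"
      using \<kappa> \<xi> Omega_pos[of \<xi> m m] m am by (intro mult_nonneg_nonneg G_nonneg) auto
    ultimately have "- V \<le> w j * ln (gap n a \<xi> j)"
      using E_ge[OF \<xi>(2)] by (simp add: V_def)
    hence "- V / w j \<le> ln (gap n a \<xi> j)"
      using pos_divide_le_eq[OF w[OF j], of "- V"] by (simp only: mult.commute)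
    hence "exp (- V / w j) \<le> exp (ln (gap n a \<xi> j))"
      by (simp only: exp_le_cancel_iff)
    thus ?thesis
      using gap_bounds(1)[OF \<xi>(1) j] by (simp add: \<eta>_def)
  qed

  \<comment> \<open>This solves \<open>exp (- 1 / 4) * - ln y \<le> B\<close> for
    \<open>y = \<xi> m / a m\<close>. If \<open>y > 1\<close> the bound is immediate, as
    \<open>B \<ge> 0\<close> makes the exponential at most 1.\<close>
  define \<delta> where "\<delta> = a m * exp (- (B * exp (1 / 4)))"
  have \<delta>: "\<delta> > 0"
    using am by (simp add: \<delta>_def)
  have lower: "\<delta> \<le> \<xi> m" if \<xi>: "\<xi> \<in> Omega m" "E n m u a k d A \<xi> \<le> c" for \<xi>
  proof -
    define y where "y = \<xi> m / a m"
    have y: "y > 0"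
      using \<xi> Omega_pos[of \<xi> m m] m am by (simp add: y_def)
    have "exp (- (B * exp (1 / 4))) \<le> y"
    proof (cases "y \<le> 1")
      case True
      have "exp (- 1 / 4) * - ln y \<le> B"
        using G_ge_ln[OF n y True] G_le_B[OF \<xi>] by (simp add: y_def)
      hence "- (B * exp (1 / 4)) \<le> ln y"
        by (simp add: exp_minus field_simps)
      hence "exp (- (B * exp (1 / 4))) \<le> exp (ln y)"
        by (simp only: exp_le_cancel_iff)
      thus ?thesis using y by simp
    next
      case False
      moreover have "exp (- (B * exp (1 / 4))) \<le> 1"
        using B(1) by simp
      ultimately show ?thesis by linarith
    qed
    thus ?thesis
      using am by (simp add: \<delta>_def y_def field_simps)
  qed

  have "\<forall>\<^sub>F y in at_top. G n (ereal y) < \<eta> 0"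
    using G_tendsto_0[OF n] by (rule order_tendstoD) (simp add: \<eta>_def)
  then obtain R where R: "\<And>y. y \<ge> R \<Longrightarrow> G n (ereal y) < \<eta> 0"
    by (auto simp: eventually_at_top_linorder)
  have a0: "a 0 > 0"
    using a by simp
  have upper: "\<xi> 1 \<le> R * a 0" if \<xi>: "\<xi> \<in> Omega m" "E n m u a k d A \<xi> \<le> c" for \<xi>
  proof -
    \<comment> \<open>For \<open>i = 0\<close> the subtracted value is \<open>G\<close> at infinity,
      namely 0, so the difference is a single value of \<open>G\<close>.\<close>
    have "\<eta> 0 \<le> G n (ereal (\<xi> 1 / a 0))"
      using gap_ge[OF \<xi>, of 0] m a0 by (simp add: gap_eq)
    hence "\<xi> 1 / a 0 \<le> R"
      using R[of "\<xi> 1 / a 0"] by linarith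
    thus ?thesis
      using a0 by (simp add: field_simps)
  qed

  show thesis
  proof (rule that[of \<delta> \<eta> "R * a 0"])
    fix \<xi> i assume \<xi>: "\<xi> \<in> Omega m" "E n m u a k d A \<xi> \<le> c" and i: "i \<in> {1..m}"
    show "\<xi> i \<in> {\<delta>..R * a 0}"
      using lower[OF \<xi>] upper[OF \<xi>] Omega_antimono[OF \<xi>(1), of i m] Omega_antimono[OF \<xi>(1), of 1 i] i
      by auto
  qed (use \<delta> gap_ge in \<open>auto simp: \<eta>_def\<close>)
qed

section \<open>Continuity of \<open>E\<close> and compactness of the sublevel set\<close>

lemma tendsto_gap:
  assumes "n \<ge> 2" "\<And>i. i \<in> {1..m} \<Longrightarrow> ((\<lambda>x. f x i) \<longlongrightarrow> \<xi> i) F"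
    and "\<And>i. i \<in> {1..m} \<Longrightarrow> \<xi> i > 0" "i < m" "a i > 0"
  shows "((\<lambda>x. gap n a (f x) i) \<longlongrightarrow> gap n a \<xi> i) F"
  using assms by (auto simp: gap_eq intro!: tendsto_intros tendsto_G divide_pos_pos)

text \<open>An arbitrary filter is allowed so that the result applies to \<open>atin\<close> of a
  subspace of the product. Nonzero differences are what continuity of \<open>ln\<close>
  requires.\<close>

lemma tendsto_E:
  assumes "n \<ge> 2" "m \<ge> 1" "\<And>i. i \<in> {1..m} \<Longrightarrow> ((\<lambda>x. f x i) \<longlongrightarrow> \<xi> i) F"
    and "\<And>i. i \<in> {1..m} \<Longrightarrow> \<xi> i > 0" "\<And>i. i \<le> m \<Longrightarrow> a i > 0"
    and "\<And>i. i < m \<Longrightarrow> gap n a \<xi> i \<noteq> 0"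
  shows "((\<lambda>x. E n m u a k d A (f x)) \<longlongrightarrow> E n m u a k d A \<xi>) F"
proof -
  have am: "a m > 0" "a m \<noteq> 0" using assms(5)[of m] by auto
  show ?thesis
    unfolding E_eq[where a = a, OF assms(2) am(1)] using assms am
    by (intro tendsto_intros tendsto_gap[where m = m] tendsto_G) auto
qed

theorem theorem2p1:
  fixes n m :: nat and u a k d :: "nat \<Rightarrow> real" and A c :: real
  assumes "n \<ge> 2" and "m \<ge> 1"
    and "\<And>i. i < m \<Longrightarrow> u i < u (i + 1)"
    and "\<And>i. i \<le> m \<Longrightarrow> a i > 0"
    and "\<And>i. i \<le> m \<Longrightarrow> k i > 0"
    and "\<And>i. 1 \<le> i \<Longrightarrow> i \<le> m \<Longrightarrow> d i \<ge> 0"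
    and "A > 0"
  shows "compactin (powertop_real {1..m}) {\<xi> \<in> Omega m. E n m u a k d A \<xi> \<le> c}"
proof -
  obtain \<delta> M \<eta> where \<delta>: "\<delta> > 0" and \<eta>: "\<And>i. i < m \<Longrightarrow> \<eta> i > 0"
    and box: "\<And>\<xi> i. \<xi> \<in> Omega m \<Longrightarrow> E n m u a k d A \<xi> \<le> c \<Longrightarrow> i \<in> {1..m} \<Longrightarrow> \<xi> i \<in> {\<delta>..M}"
    and gap_ge: "\<And>\<xi> i. \<xi> \<in> Omega m \<Longrightarrow> E n m u a k d A \<xi> \<le> c \<Longrightarrow> i < m \<Longrightarrow> \<eta> i \<le> gap n a \<xi> i"
    by (rule sublevel_bounds[of n m u a k d A c]) (use assms in blast)+
  let ?X = "powertop_real {1..m}"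
  \<comment> \<open>The box is compact and keeps all coordinates positive, but it may contain points
    with coordinates out of order, hence outside \<open>Omega m\<close>.\<close>
  define K where "K = (\<Pi>\<^sub>E i\<in>{1..m}. {\<delta>..M})"
  have K: "compactin ?X K"
    unfolding K_def by (subst compactin_PiE) auto
  have K_sub: "K \<subseteq> topspace ?X"
    by (auto simp: K_def)
  have coord: "((\<lambda>\<zeta>. \<zeta> i) \<longlongrightarrow> \<xi> i) (atin (subtopology ?X S) \<xi>)"
    if "i \<in> {1..m}" "\<xi> \<in> topspace (subtopology ?X S)" for i \<xi> S
  proof -
    have "continuous_map (subtopology ?X S) euclideanreal (\<lambda>\<zeta>. \<zeta> i)"
      using that by (intro continuous_map_from_subtopology continuous_map_product_projection)
    thus ?thesis
      using that by (simp add: continuous_map_atin)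
  qed
  have K_pos: "\<xi> i > 0" if "\<xi> \<in> K" "i \<in> {1..m}" for \<xi> i
    using that \<delta> by (force simp: K_def PiE_iff)
  have closed_K: "closedin (subtopology ?X K) {\<xi> \<in> topspace (subtopology ?X K). gap n a \<xi> i \<in> {\<eta> i..}}"
    if "i < m" for i
  proof (rule closedin_continuous_map_preimage)
    show "continuous_map (subtopology ?X K) euclideanreal (\<lambda>\<xi>. gap n a \<xi> i)"
      unfolding continuous_map_atin limitin_canonical_iff
      using that assms coord K_pos by (intro ballI tendsto_gap[where m = m]) auto
  qed auto
  \<comment> \<open>The nonstrict conditions make \<open>L\<close> closed in \<open>K\<close>, yet
    \<open>\<eta> i > 0\<close> forces the strict ordering of \<open>Omega m\<close> and keeps the
    logarithms of \<open>E\<close> continuous on \<open>L\<close>.\<close>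
  define L where "L = {\<xi> \<in> K. \<forall>i<m. \<eta> i \<le> gap n a \<xi> i}"
  have "L = K \<inter> (\<Inter>i\<in>{..<m}. {\<xi> \<in> topspace (subtopology ?X K). gap n a \<xi> i \<in> {\<eta> i..}})"
    using K_sub by (auto simp: L_def)
  also have "closedin (subtopology ?X K) \<dots>"
    \<comment> \<open>\<open>m \<ge> 1\<close> makes the index set nonempty, as
      \<open>closedin_INT\<close> demands.\<close>
    using closed_K assms(2) K_sub
    by (intro closedin_Int closedin_INT) (auto simp: closedin_subtopology_refl lessThan_empty_iff)
  finally have "compactin (subtopology ?X K) L"
    using K by (intro closedin_compact_space) (auto simp: compact_space_subtopology)
  hence L: "compactin ?X L"
    by (simp add: compactin_subtopology)
  have "continuous_map (subtopology ?X L) euclideanreal (E n m u a k d A)"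
    unfolding continuous_map_atin limitin_canonical_iff
  proof
    fix \<xi> assume \<xi>: "\<xi> \<in> topspace (subtopology ?X L)"
    hence "\<xi> \<in> L" by simp
    hence "gap n a \<xi> i \<noteq> 0" if "i < m" for i
      using that \<eta>[OF that] by (force simp: L_def)
    thus "(E n m u a k d A \<longlongrightarrow> E n m u a k d A \<xi>) (atin (subtopology ?X L) \<xi>)"
      using \<open>\<xi> \<in> L\<close> \<xi> coord K_pos assms by (intro tendsto_E) (auto simp: L_def)
  qed
  hence "closedin (subtopology ?X L) {\<xi> \<in> topspace (subtopology ?X L). E n m u a k d A \<xi> \<in> {..c}}"
    by (rule closedin_continuous_map_preimage) auto
  hence "compactin (subtopology ?X L) {\<xi> \<in> topspace (subtopology ?X L). E n m u a k d A \<xi> \<in> {..c}}"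
    using L by (intro closedin_compact_space) (auto simp: compact_space_subtopology)
  hence "compactin ?X {\<xi> \<in> topspace (subtopology ?X L). E n m u a k d A \<xi> \<in> {..c}}"
    by (simp add: compactin_subtopology)
  also have "{\<xi> \<in> topspace (subtopology ?X L). E n m u a k d A \<xi> \<in> {..c}}
      = {\<xi> \<in> Omega m. E n m u a k d A \<xi> \<le> c}"
  proof (intro equalityI subsetI)
    fix \<xi> assume "\<xi> \<in> {\<xi> \<in> topspace (subtopology ?X L). E n m u a k d A \<xi> \<in> {..c}}"
    hence \<xi>: "\<xi> \<in> K" "\<xi> \<in> topspace ?X" "E n m u a k d A \<xi> \<le> c" and gap: "\<And>i. i < m \<Longrightarrow> \<eta> i \<le> gap n a \<xi> i"
      by (auto simp: L_def)
    \<comment> \<open>Coordinates out of order would make the difference nonpositive, since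
      \<open>G\<close> decreases; this contradicts the lower bound \<open>\<eta> i\<close>.\<close>
    have "\<xi> (i + 1) < \<xi> i" if "i \<in> {1..<m}" for i
    proof (rule ccontr)
      assume "\<not> \<xi> (i + 1) < \<xi> i"
      moreover have "a i > 0" "\<xi> i > 0"
        using that assms(4) K_pos[OF \<xi>(1)] by auto
      ultimately have "G n (ereal (\<xi> (i + 1) / a i)) \<le> G n (ereal (\<xi> i / a i))"
        by (intro G_antimono divide_right_mono assms(1)) auto
      hence "gap n a \<xi> i \<le> 0"
        using that \<open>a i > 0\<close> by (simp add: gap_eq)
      thus False
        using gap[of i] \<eta>[of i] that by simp
    qed
    thus "\<xi> \<in> {\<xi> \<in> Omega m. E n m u a k d A \<xi> \<le> c}"
      using \<xi> K_pos[OF \<xi>(1), of m] assms(2) by (auto simp: Omega_def)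
  next
    fix \<xi> assume "\<xi> \<in> {\<xi> \<in> Omega m. E n m u a k d A \<xi> \<le> c}"
    hence \<xi>: "\<xi> \<in> Omega m" "E n m u a k d A \<xi> \<le> c" by auto
    moreover have "\<xi> \<in> K"
      using \<xi>(1) box[OF \<xi>] by (auto simp: K_def Omega_def PiE_iff)
    ultimately show "\<xi> \<in> {\<xi> \<in> topspace (subtopology ?X L). E n m u a k d A \<xi> \<in> {..c}}"
      using gap_ge[OF \<xi>] K_sub by (auto simp: L_def)
  qed
  finally show ?thesis .
qed
end
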